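(* The trivial packing is optimal for packing $33$ unit squares in a square, and $s(33)=6$.
   Context: For a positive integer $n$, $s(n)$ denotes the side length of the smallest square into which $n$ non-overlapping unit squares can be packed. Here all squares are in the Euclidean plane; unit squares (closed squares of side length $1$) may be placed in arbitrary position and with arbitrary orientation (rotations are allowed); they are non-overlapping if their interiors are pairwise disjoint; and they are packed in a (closed) square $S$ if each of them is a subset of $S$. The trivial (or "chess board") packing of $33$ unit squares places them in $33$ distinct cells of the $6\times 6$ grid of unit cells subdividing a square of side length $6$; it is optimal if no square of smaller side length admits a packing of $33$ non-overlapping unit squares. *)

theory Defs
  imports "HOL-Analysis.Analysis"
begin

definition orthonormal_frame :: "real^2 \<Rightarrow> real^2 \<Rightarrow> bool" where
  "orthonormal_frame u v \<longleftrightarrow> norm u = 1 \<and> norm v = 1 \<and> u \<bullet> v = 0"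

text \<open>The closed square with corner \<open>p\<close> and sides of length \<open>a\<close> along \<open>u\<close> and \<open>v\<close>,
  where \<open>u\<close> and \<open>v\<close> are meant to be orthonormal.\<close>

definition frame_square :: "real^2 \<Rightarrow> real^2 \<Rightarrow> real^2 \<Rightarrow> real \<Rightarrow> (real^2) set" where
  "frame_square p u v a = {p + x *\<^sub>R u + y *\<^sub>R v | x y. 0 \<le> x \<and> x \<le> a \<and> 0 \<le> y \<and> y \<le> a}"

definition is_square :: "real \<Rightarrow> (real^2) set \<Rightarrow> bool" where
  "is_square a S \<longleftrightarrow> a > 0 \<and> (\<exists>p u v. orthonormal_frame u v \<and> S = frame_square p u v a)"

text \<open>The \<open>n\<close> unit squares form a family indexed by \<open>{..<n}\<close>; its members are automatically
  distinct, since their interiors are nonempty and pairwise disjoint.\<close>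

definition is_packing :: "nat \<Rightarrow> (nat \<Rightarrow> (real^2) set) \<Rightarrow> (real^2) set \<Rightarrow> bool" where
  "is_packing n Q S \<longleftrightarrow>
     (\<forall>i<n. is_square 1 (Q i)) \<and>
     disjoint_family_on (\<lambda>i. interior (Q i)) {..<n} \<and>
     (\<forall>i<n. Q i \<subseteq> S)"

definition packable :: "nat \<Rightarrow> real \<Rightarrow> bool" where
  "packable n a \<longleftrightarrow> (\<exists>S Q. is_square a S \<and> is_packing n Q S)"

definition s :: "nat \<Rightarrow> real" where
  "s n = (LEAST a. packable n a)"

definition optimal_packing :: "nat \<Rightarrow> real \<Rightarrow> (nat \<Rightarrow> (real^2) set) \<Rightarrow> (real^2) set \<Rightarrow> bool" where
  "optimal_packing n a Q S \<longleftrightarrow>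
     is_square a S \<and> is_packing n Q S \<and> (\<forall>b<a. \<not> packable n b)"

definition grid_cell :: "real^2 \<Rightarrow> real^2 \<Rightarrow> real^2 \<Rightarrow> nat \<times> nat \<Rightarrow> (real^2) set" where
  "grid_cell p u v = (\<lambda>(i, j). frame_square (p + real i *\<^sub>R u + real j *\<^sub>R v) u v 1)"

text \<open>\<open>Q\<close> places \<open>n\<close> unit squares in distinct cells of the \<open>m \<times> m\<close> grid of unit cells
  subdividing the square \<open>S\<close> of side length \<open>m\<close>; which cells are used is left open.\<close>

definition trivial_packing :: "nat \<Rightarrow> nat \<Rightarrow> (nat \<Rightarrow> (real^2) set) \<Rightarrow> (real^2) set \<Rightarrow> bool" where
  "trivial_packing m n Q S \<longleftrightarrow>
     (\<exists>p u v c. orthonormal_frame u v \<and> S = frame_square p u v (real m) \<and>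
        inj_on c {..<n} \<and> c ` {..<n} \<subseteq> {..<m} \<times> {..<m} \<and>
        (\<forall>i<n. Q i = grid_cell p u v (c i)))"

end

theory Submission
  imports Defs
begin

text \<open>
  If 33 unit squares fit into a square of side less than 6, rescaling gives 33 pairwise disjoint closed unit
  squares in \<open>[0,6]\<^sup>2\<close>. Put six horizontal rows of points at height distance 0.866, alternately with
  abscissae 1, 2, ..., 5 and 1/2, 3/2, ..., 11/2. Such a set has 33 points, meets every unit square in
  \<open>[0,6]\<^sup>2\<close>, and can be translated vertically by 0.158 without losing this property. Hence each of the 33
  squares contains exactly one point of each translate, and by continuity it is always the same point that
  moves; so every square contains or avoids each of the vertical segments swept out by the points. The same
  holds for the mirror image, where the two types of rows are exchanged.

  Consider both sets together, but replace the six points with abscissa 1/2 by the five points (0.914, k),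
  k = 1, ..., 5. This leaves 65 points, whereas each of the 33 squares still contains two of them: a square
  near the left wall contains some (0.914, k), and a square further right that contains a point with abscissa
  1/2 but no (0.914, k) is tilted by almost 45 degrees and would contain two points of one of the sets.
\<close>

section \<open>Unit squares in coordinates and their symmetries\<close>

text \<open>\<open>usq a b c sn\<close> is the closed unit square with centre \<open>(a, b)\<close> and sides parallel to
  \<open>(c, sn)\<close> and \<open>(- sn, c)\<close>.\<close>

definition usq :: "real \<Rightarrow> real \<Rightarrow> real \<Rightarrow> real \<Rightarrow> real \<Rightarrow> real \<Rightarrow> bool" where
  "usq a b c sn x y \<longleftrightarrow>
     \<bar>(x - a) * c + (y - b) * sn\<bar> \<le> 1 / 2 \<and> \<bar>(y - b) * c - (x - a) * sn\<bar> \<le> 1 / 2"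

text \<open>A square is invariant under quarter turns, so directions in the closed first quadrant
  represent all orientations; \<open>usq_normalize\<close> carries out this reduction.\<close>

definition direction :: "real \<Rightarrow> real \<Rightarrow> bool" where
  "direction c sn \<longleftrightarrow> c \<ge> 0 \<and> sn \<ge> 0 \<and> c\<^sup>2 + sn\<^sup>2 = 1"

lemma direction_swap: "direction c sn \<Longrightarrow> direction sn c"
  by (simp add: direction_def add.commute)

lemma usq_transpose: "usq b a sn c y x \<longleftrightarrow> usq a b c sn x y"
  unfolding usq_def by (smt (verit, best))

text \<open>Reflection combined with a quarter turn replaces an angle \<theta> by \<pi> / 2 -
  \<theta>. Hence \<open>c\<close> and \<open>sn\<close> change places and both stay
  nonnegative.\<close>

lemma usq_reflect: "usq (6 - a) b sn c (6 - x) y \<longleftrightarrow> usq a b c sn x y"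
  unfolding usq_def by (smt (verit, best) minus_diff_eq mult_minus_left)

lemma usq_reflect': "usq a (6 - b) sn c x (6 - y) \<longleftrightarrow> usq a b c sn x y"
  using usq_reflect[of b a c sn y x] by (metis usq_transpose)

lemma direction_bounds:
  assumes "direction c sn"
  shows "c \<le> 1" "sn \<le> 1" "1 \<le> c + sn" "(c + sn)\<^sup>2 \<le> 2" "2 * (c * sn) \<le> 1" "(c + sn)\<^sup>2 = 1 + 2 * (c * sn)"
proof -
  have h: "c \<ge> 0" "sn \<ge> 0" "c\<^sup>2 + sn\<^sup>2 = 1" using assms by (auto simp: direction_def)
  show "c \<le> 1" "sn \<le> 1" using h by (smt (verit) power2_le_imp_le one_power2 zero_le_power2)+
  show e: "(c + sn)\<^sup>2 = 1 + 2 * (c * sn)" using h(3) by (simp add: power2_sum)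
  have "1\<^sup>2 \<le> (c + sn)\<^sup>2" using e h by simp
  then show "1 \<le> c + sn" using h by (meson add_nonneg_nonneg power2_le_imp_le)
  have "0 \<le> (c - sn)\<^sup>2" by simp
  then show "2 * (c * sn) \<le> 1" using h(3) by (simp add: power2_diff)
  then show "(c + sn)\<^sup>2 \<le> 2" using e by simp
qed

lemma projection_le_1:
  assumes "direction c sn" "x\<^sup>2 + y\<^sup>2 \<le> 1"
  shows "\<bar>x * c + y * sn\<bar> \<le> 1" "\<bar>y * c - x * sn\<bar> \<le> 1"
proof -
  have "(x * c + y * sn)\<^sup>2 + (y * c - x * sn)\<^sup>2 = (x\<^sup>2 + y\<^sup>2) * (c\<^sup>2 + sn\<^sup>2)"
    by algebra
  also have "\<dots> \<le> 1" using assms by (simp add: direction_def)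
  finally have "(x * c + y * sn)\<^sup>2 \<le> 1\<^sup>2" "(y * c - x * sn)\<^sup>2 \<le> 1\<^sup>2"
    by (smt (verit) one_power2 zero_le_power2)+
  then show "\<bar>x * c + y * sn\<bar> \<le> 1" "\<bar>y * c - x * sn\<bar> \<le> 1"
    by (simp_all add: abs_square_le_1)
qed

section \<open>Triangles, walls and strips that force a square to contain a point\<close>

lemma convex_combination_pos:
  fixes X :: real
  assumes "\<alpha> \<ge> 0" "\<beta> \<ge> 0" "\<gamma> \<ge> 0" "\<alpha> + \<beta> + \<gamma> = 1" "X > 0" "Y > 0" "Z > 0"
  shows "\<alpha> * X + \<beta> * Y + \<gamma> * Z \<noteq> 0"
proof -
  have "\<alpha> * X \<ge> 0" "\<beta> * Y \<ge> 0" "\<gamma> * Z \<ge> 0" using assms by simp_all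
  moreover have "\<alpha> > 0 \<or> \<beta> > 0 \<or> \<gamma> > 0" using assms by linarith
  ultimately show ?thesis using assms
    by (metis add_nonneg_nonneg add_nonneg_pos add_pos_nonneg less_irrefl mult_pos_pos)
qed

text \<open>A linear form with one of four sign patterns would be positive at all three vertices.\<close>

lemma triangle_lemma_aux:
  fixes f1 :: real
  assumes bary: "\<alpha> \<ge> 0" "\<beta> \<ge> 0" "\<gamma> \<ge> 0" "\<alpha> + \<beta> + \<gamma> = 1"
    and zero: "\<alpha> * f1 + \<beta> * f2 + \<gamma> * f3 = 0" "\<alpha> * g1 + \<beta> * g2 + \<gamma> * g3 = 0"
    and diff: "\<bar>f1 - f2\<bar> \<le> 1" "\<bar>f1 - f3\<bar> \<le> 1" "\<bar>f2 - f3\<bar> \<le> 1"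
      "\<bar>g1 - g2\<bar> \<le> 1" "\<bar>g1 - g3\<bar> \<le> 1" "\<bar>g2 - g3\<bar> \<le> 1"
  shows "\<bar>f1\<bar> \<le> 1 / 2 \<and> \<bar>g1\<bar> \<le> 1 / 2 \<or> \<bar>f2\<bar> \<le> 1 / 2 \<and> \<bar>g2\<bar> \<le> 1 / 2 \<or> \<bar>f3\<bar> \<le> 1 / 2 \<and> \<bar>g3\<bar> \<le> 1 / 2"
proof (rule ccontr)
  assume neg: "\<not> ?thesis"
  have lin: "\<alpha> * (p * f1 + q * g1) + \<beta> * (p * f2 + q * g2) + \<gamma> * (p * f3 + q * g3) = 0" for p q
    using zero by algebra
  have no: "\<not> (p * f1 + q * g1 > 0 \<and> p * f2 + q * g2 > 0 \<and> p * f3 + q * g3 > 0)" for p q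
    using convex_combination_pos[OF bary] lin by blast
  show False
    using neg diff no[of 1 1] no[of 1 "-1"] no[of "-1" 1] no[of "-1" "-1"]
      no[of 1 0] no[of "-1" 0] no[of 0 1] no[of 0 "-1"]
    by (simp add: abs_le_iff) argo
qed

text \<open>\<open>f\<close> and \<open>g\<close> are coordinates in the frame of the square, with
  its centre as origin. Projections do not increase lengths, so each of them varies by at most 1
  between vertices.\<close>

lemma triangle_lemma:
  assumes "direction c sn"
    and bary: "\<alpha> \<ge> 0" "\<beta> \<ge> 0" "\<gamma> \<ge> 0" "\<alpha> + \<beta> + \<gamma> = 1"
    and ctr: "a = \<alpha> * x1 + \<beta> * x2 + \<gamma> * x3" "b = \<alpha> * y1 + \<beta> * y2 + \<gamma> * y3"
    and sides: "(x1 - x2)\<^sup>2 + (y1 - y2)\<^sup>2 \<le> 1" "(x1 - x3)\<^sup>2 + (y1 - y3)\<^sup>2 \<le> 1" "(x2 - x3)\<^sup>2 + (y2 - y3)\<^sup>2 \<le> 1"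
  shows "usq a b c sn x1 y1 \<or> usq a b c sn x2 y2 \<or> usq a b c sn x3 y3"
proof -
  define f g where "f x y = (x - a) * c + (y - b) * sn" and "g x y = (y - b) * c - (x - a) * sn" for x y
  have dz: "\<alpha> * (x1 - a) + \<beta> * (x2 - a) + \<gamma> * (x3 - a) = 0" "\<alpha> * (y1 - b) + \<beta> * (y2 - b) + \<gamma> * (y3 - b) = 0"
    using bary(4) ctr by algebra+
  have "\<alpha> * f x1 y1 + \<beta> * f x2 y2 + \<gamma> * f x3 y3 = 0" "\<alpha> * g x1 y1 + \<beta> * g x2 y2 + \<gamma> * g x3 y3 = 0"
    unfolding f_def g_def using dz by algebra+
  moreover have "f x y - f x' y' = (x - x') * c + (y - y') * sn" "g x y - g x' y' = (y - y') * c - (x - x') * sn" for x y x' y'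
    by (simp_all add: f_def g_def algebra_simps)
  ultimately show ?thesis
    using triangle_lemma_aux[OF bary, of "f x1 y1" "f x2 y2" "f x3 y3" "g x1 y1" "g x2 y2" "g x3 y3"]
      projection_le_1[OF assms(1) sides(1)] projection_le_1[OF assms(1) sides(2)] projection_le_1[OF assms(1) sides(3)]
    by (simp add: usq_def f_def g_def)
qed

text \<open>If a square above the x-axis avoids both points, its top corner passes between them, so
  its chord at height \<open>\<eta>\<close> is shorter than 1. At depth d below the corner the chord
  has length d / (c * sn), and 457 / 500 < sqrt 2 - 1 / 2 keeps d too large for that.\<close>

lemma wall_lemma:
  assumes "direction c sn" "(c + sn) / 2 \<le> b" "b \<le> \<eta>" "\<eta> \<le> 457 / 500" "k \<le> a" "a \<le> k + 1"
  shows "usq a b c sn k \<eta> \<or> usq a b c sn (k + 1) \<eta>"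
proof (rule ccontr)
  assume neg: "\<not> ?thesis"
  note d = direction_bounds[OF assms(1)]
  have cs: "c \<ge> 0" "sn \<ge> 0" "c\<^sup>2 + sn\<^sup>2 = 1" using assms by (auto simp: direction_def)
  define p e h where "p = a - k" and "e = \<eta> - b" and "h = (c + sn) / 2"
  have p: "0 \<le> p" "p \<le> 1" and e: "0 \<le> e" "e \<le> 457 / 500 - h"
    using assms(2-6) unfolding p_def e_def h_def by linarith+
  have h: "1 / 2 \<le> h" using d(3) by (simp add: h_def)
  have small: "x * y \<le> 1 / 2" if "0 \<le> x" "x \<le> 1" "0 \<le> y" "y \<le> 1 / 2" for x y :: real
    using mult_mono[OF that(2,4)] that by simp
  have ee: "e * c \<le> 1 / 2" "e * sn \<le> 1 / 2" using small[of c e] small[of sn e] cs d e h by (simp_all add: mult.commute)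
  have pn: "p * c \<ge> 0" "p * sn \<ge> 0" "(1 - p) * c \<ge> 0" "(1 - p) * sn \<ge> 0" "e * c \<ge> 0" "e * sn \<ge> 0"
    using p e cs by simp_all
  \<comment> \<open>Each disjunct names a side of the square beyond which the point lies; the
    remaining two sides are excluded by \<open>pn\<close> and \<open>ee\<close>.\<close>
  have A: "p * c - e * sn > 1 / 2 \<or> p * sn + e * c > 1 / 2"
  proof -
    have "\<not> usq a b c sn k \<eta>" using neg by simp
    then have "\<not> (\<bar>e * sn - p * c\<bar> \<le> 1 / 2 \<and> \<bar>e * c + p * sn\<bar> \<le> 1 / 2)"
      by (simp add: usq_def p_def e_def algebra_simps)
    then show ?thesis using pn ee by linarith
  qed
  have B: "(1 - p) * c + e * sn > 1 / 2 \<or> (1 - p) * sn - e * c > 1 / 2"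
  proof -
    have "\<not> usq a b c sn (k + 1) \<eta>" using neg by simp
    then have "\<not> (\<bar>(1 - p) * c + e * sn\<bar> \<le> 1 / 2 \<and> \<bar>e * c - (1 - p) * sn\<bar> \<le> 1 / 2)"
      by (simp add: usq_def p_def e_def algebra_simps)
    then show ?thesis using pn ee by linarith
  qed
  have "p * c + (1 - p) * sn \<le> 1"
    using mult_left_mono[OF d(1) p(1)] mult_left_mono[OF d(2), of "1 - p"] p by simp
  then have 1: "\<not> (p * c - e * sn > 1 / 2 \<and> (1 - p) * sn - e * c > 1 / 2)" using pn by linarith
  have 2: "\<not> (p * c - e * sn > 1 / 2 \<and> (1 - p) * c + e * sn > 1 / 2)" using d(1) by (simp add: algebra_simps)
  have 3: "\<not> (p * sn + e * c > 1 / 2 \<and> (1 - p) * sn - e * c > 1 / 2)" using d(2) by (simp add: algebra_simps)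
  \<comment> \<open>What remains is that the two points lie beyond different upper sides.\<close>
  have AB: "p * sn + e * c > 1 / 2" "(1 - p) * c + e * sn > 1 / 2" using A B 1 2 3 by auto
  have "c > 0" using AB(2) e h cs small[of sn e] d by (cases "c = 0") auto
  have "sn > 0" using AB(1) e h cs small[of c e] d by (cases "sn = 0") (auto simp: mult.commute)
  \<comment> \<open>Weights \<open>c\<close> and \<open>sn\<close> eliminate \<open>p\<close> and
    leave the comparison of the chord with 1.\<close>
  have "c * (p * sn + e * c) + sn * ((1 - p) * c + e * sn) > c * (1 / 2) + sn * (1 / 2)"
    using AB \<open>c > 0\<close> \<open>sn > 0\<close> by (intro add_strict_mono mult_strict_left_mono)
  moreover have "c * (p * sn + e * c) + sn * ((1 - p) * c + e * sn) = c * sn + e * (c\<^sup>2 + sn\<^sup>2)"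
    by (simp add: algebra_simps power2_eq_square)
  ultimately have "h < c * sn + e" using cs by (simp add: h_def)
  moreover have "c * sn = 2 * h\<^sup>2 - 1 / 2" using d(6) by (simp add: h_def power_divide field_simps)
  ultimately have "2 * h - 2 * h\<^sup>2 + 1 / 2 < 457 / 500" using e by simp
  \<comment> \<open>442 / 625 = 0.7072 is just above sqrt 2 / 2.\<close>
  moreover have "h \<le> 442 / 625" 
  proof -
    have "h\<^sup>2 \<le> (442 / 625)\<^sup>2" using d(4) by (simp add: h_def power_divide)
    then show ?thesis by (rule power2_le_imp_le) simp
  qed
  \<comment> \<open>By concavity, \<open>h - h\<^sup>2\<close> lies above its secant between 1 / 2
    and 442 / 625.\<close>
  moreover have "h * (1509 / 1250) - h\<^sup>2 - 221 / 625 \<ge> 0"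
  proof -
    have "(442 / 625 - h) * (h - 1 / 2) = h * (1509 / 1250) - h\<^sup>2 - 221 / 625" by algebra
    then show ?thesis using \<open>h \<le> 442 / 625\<close> h by (metis diff_ge_0_iff_ge mult_nonneg_nonneg)
  qed
  ultimately show False using h by linarith
qed

text \<open>The two rows triangulate the strip between them, with sides at most 1 because (433 /
  500)^2 + 1 / 4 < 1. The triangle around the centre is passed to
  \<open>triangle_lemma\<close>.\<close>

lemma strip_lemma:
  assumes "direction c sn" "y \<le> b" "b \<le> y + 433 / 500"
  shows "\<exists>k::int. usq a b c sn (x0 + of_int k) y \<or> usq a b c sn (x0 + 1 / 2 + of_int k) (y + 433 / 500)"
proof -
  \<comment> \<open>\<open>f\<close> and \<open>w\<close> are the coordinates of the centre in a
    lattice cell spanned by (1, 0) and (1 / 2, g); whether f + w exceeds 1 decides between the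
    upright and the inverted triangle.\<close>
  define g w r f where "g = (433 / 500 :: real)" and "w = (b - y) / g" and "r = a - x0 - w / 2"
    and "f = r - of_int \<lfloor>r\<rfloor>"
  define k where "k = (of_int \<lfloor>r\<rfloor> :: real)"
  have w: "0 \<le> w" "w \<le> 1" and f: "0 \<le> f" "f \<le> 1"
    using assms(2,3) by (auto simp: w_def g_def f_def) linarith+
  have b: "b = y + w * g" by (simp add: w_def g_def field_simps)
  have a: "a = x0 + k + f + w / 2" by (simp add: f_def k_def r_def)
  have g: "g\<^sup>2 + (1 / 2)\<^sup>2 \<le> 1" by (simp add: g_def power2_eq_square)
  show ?thesis
  proof (cases "f + w \<le> 1")
    case True
    have "usq a b c sn (x0 + k) y \<or> usq a b c sn (x0 + k + 1) y \<or> usq a b c sn (x0 + k + 1 / 2) (y + g)"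
      by (rule triangle_lemma[OF assms(1), of "1 - f - w" f w])
        (use True w f g in \<open>simp_all add: a b algebra_simps power2_eq_square\<close>)
    then show ?thesis
      by (metis (no_types, opaque_lifting) add.assoc add.commute g_def k_def of_int_1 of_int_add)
  next
    case False
    have "usq a b c sn (x0 + k + 1) y \<or> usq a b c sn (x0 + k + 3 / 2) (y + g) \<or> usq a b c sn (x0 + k + 1 / 2) (y + g)"
      by (rule triangle_lemma[OF assms(1), of "1 - w" "f + w - 1" "1 - f"])
        (use False w f g in \<open>simp_all add: a b field_simps power2_eq_square\<close>)
    moreover have "x0 + k + 1 = x0 + of_int (\<lfloor>r\<rfloor> + 1)" "x0 + k + 3 / 2 = x0 + 1 / 2 + of_int (\<lfloor>r\<rfloor> + 1)"
      "x0 + k + 1 / 2 = x0 + 1 / 2 + of_int \<lfloor>r\<rfloor>" by (simp_all add: k_def)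
    ultimately show ?thesis unfolding g_def by metis
  qed
qed

section \<open>Squares touching the sides of the box, and squares inside it\<close>

text \<open>A tilted square to the right of the line x = 0 can meet it only in a corner, and the
  horizontal chord from that corner has length 1 / max c sn \<ge> 1.\<close>

lemma touch_lemma:
  assumes "direction c sn" "(c + sn) / 2 \<le> a" "usq a b c sn 0 y"
  shows "usq a b c sn 1 y"
proof -
  have cs: "c \<ge> 0" "sn \<ge> 0" "c\<^sup>2 + sn\<^sup>2 = 1" using assms by (auto simp: direction_def)
  note d = direction_bounds[OF assms(1)]
  define q where "q = y - b"
  have A: "\<bar>q * sn - a * c\<bar> \<le> 1 / 2" "\<bar>q * c + a * sn\<bar> \<le> 1 / 2"
    using assms(3) by (simp_all add: usq_def q_def algebra_simps)
  \<comment> \<open>A weighted sum of two nonnegative slacks is not positive, so both terms vanish: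
    the point is a corner unless a weight is 0.\<close>
  have "c * (1 / 2 - (a * c - q * sn)) + sn * (1 / 2 - (q * c + a * sn)) = (c + sn) / 2 - a * (c\<^sup>2 + sn\<^sup>2)"
    by (simp add: algebra_simps power2_eq_square)
  also have "\<dots> \<le> 0" using assms(2) cs by simp
  finally have "c * (1 / 2 - (a * c - q * sn)) \<le> 0 \<and> sn * (1 / 2 - (q * c + a * sn)) \<le> 0"
    using cs A by (smt (verit) mult_nonneg_nonneg)
  then have "c = 0 \<or> a * c - q * sn \<ge> 1 / 2" "sn = 0 \<or> q * c + a * sn \<ge> 1 / 2"
    using cs by (auto simp: mult_le_0_iff)
  moreover have a2: "a \<ge> 1 / 2" using assms(2) d(3) by simp
  moreover have "c = 0 \<Longrightarrow> sn = 1" "sn = 0 \<Longrightarrow> c = 1" using cs d(3) by (auto simp: power2_eq_1_iff)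
  ultimately consider "c = 0" "sn = 1" | "sn = 0" "c = 1" | "q * sn - a * c = - (1 / 2)" "q * c + a * sn = 1 / 2"
    using A by (auto simp: abs_le_iff)
  then have "\<bar>(q * sn - a * c) + c\<bar> \<le> 1 / 2 \<and> \<bar>(q * c + a * sn) - sn\<bar> \<le> 1 / 2"
  proof cases
    case 3
    then show ?thesis unfolding 3 using cs(1,2) d(1,2) by (auto simp: abs_if)
  qed (use A a2 in \<open>auto simp: abs_le_iff\<close>)
  then show ?thesis by (simp add: usq_def q_def algebra_simps)
qed

text \<open>One half of \<open>tall_chord_lemma\<close>, with heights relative to the centre. The
  point of the conclusion lies 1 / 2 to the right of and 433 / 500 below the point of
  \<open>P2\<close>. A side separating the two would be steep, sn < 3 / 5 * c, and then the distance
  from the wall forces c + sn^2 < 1, contrary to c^2 + sn^2 = 1.\<close>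

lemma tall_chord_aux:
  fixes Y1 :: real
  assumes cs: "c > 0" "sn > 0" "c\<^sup>2 + sn\<^sup>2 = 1" and a: "(c + sn) / 2 \<le> a"
    and P2: "(1 / 2 - a) * c + Y2 * sn \<le> 1 / 2" "Y2 * c - (1 / 2 - a) * sn \<le> 1 / 2"
    and Y: "Y2 - Y1 = 128 / 125"
  shows "(1 - a) * c + (Y1 + 79 / 500) * sn \<le> 1 / 2"
proof (rule ccontr)
  assume neg: "\<not> ?thesis"
  have Y1: "Y1 = Y2 - 128 / 125" using Y by simp
  have "sn * (433 / 500) < c / 2" using neg P2(1) by (simp add: Y1 algebra_simps)
  then have sc: "sn < 3 / 5 * c" using cs by simp
  have "c * ((1 - a) * c + (Y1 + 79 / 500) * sn) > c * (1 / 2)" using neg cs by simp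
  moreover have "sn * (Y2 * c - (1 / 2 - a) * sn) \<le> sn * (1 / 2)" using P2(2) cs by simp
  moreover have "c * ((1 - a) * c + (Y1 + 79 / 500) * sn) - sn * (Y2 * c - (1 / 2 - a) * sn)
     = c\<^sup>2 + sn\<^sup>2 / 2 - a * (c\<^sup>2 + sn\<^sup>2) - 433 / 500 * (c * sn)"
    by (simp add: Y1 algebra_simps power2_eq_square)
  moreover have "a * (c\<^sup>2 + sn\<^sup>2) = a" using cs(3) by simp
  ultimately have "c / 2 - sn / 2 < c\<^sup>2 + sn\<^sup>2 / 2 - a - 433 / 500 * (c * sn)" by linarith
  then have "c / 2 - sn / 2 + (c + sn) / 2 < 1 - sn\<^sup>2 / 2 - 433 / 500 * (c * sn)" using a cs(3) by linarith
  then have 1: "c + sn * sn / 2 + 433 / 500 * (c * sn) < 1" by (simp add: power2_eq_square add_divide_distrib diff_divide_distrib)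
  have "sn * sn > 0" "c * sn > 0" using cs by simp_all
  then have "c < 1" using 1 by linarith
  have "sn * sn \<le> 3 / 5 * (c * sn)" using mult_right_mono[of sn "3 / 5 * c" sn] sc cs by (simp add: mult.assoc)
  moreover have "c * c \<le> c" using mult_left_mono[of c 1 c] cs(1) \<open>c < 1\<close> by simp
  moreover have "c * c + sn * sn = 1" using cs(3) by (simp add: power2_eq_square)
  moreover have "c * sn > 0" using cs by simp
  ultimately show False using 1 by linarith
qed

text \<open>A square in direction \<open>(c, sn)\<close> extends \<open>(c + sn) / 2\<close> from its centre along both axes, so this
  says that it lies in \<open>[0,6]\<^sup>2\<close>.\<close>

definition inscribed :: "real \<Rightarrow> real \<Rightarrow> real \<Rightarrow> real \<Rightarrow> bool" where
  "inscribed a b c sn \<longleftrightarrow> direction c sn \<and> (c + sn) / 2 \<le> a \<and> a \<le> 6 - (c + sn) / 2 \<and>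
     (c + sn) / 2 \<le> b \<and> b \<le> 6 - (c + sn) / 2"

lemma inscribedD:
  assumes "inscribed a b c sn"
  shows "direction c sn" "(c + sn) / 2 \<le> a" "a \<le> 6 - (c + sn) / 2" "(c + sn) / 2 \<le> b" "b \<le> 6 - (c + sn) / 2"
    and "c \<ge> 0" "sn \<ge> 0" "c\<^sup>2 + sn\<^sup>2 = 1"
  using assms unfolding inscribed_def direction_def by blast+

lemma inscribed_transpose: "inscribed a b c sn \<Longrightarrow> inscribed b a sn c"
  by (auto simp: inscribed_def direction_swap field_simps)

lemma inscribed_reflect: "inscribed a b c sn \<Longrightarrow> inscribed (6 - a) b sn c"
  by (auto simp: inscribed_def direction_swap field_simps)

lemma usq_iff:
  "usq a b c sn x y \<longleftrightarrow>
     - (1 / 2) \<le> (x - a) * c + (y - b) * sn \<and> (x - a) * c + (y - b) * sn \<le> 1 / 2 \<and>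
     - (1 / 2) \<le> (y - b) * c - (x - a) * sn \<and> (y - b) * c - (x - a) * sn \<le> 1 / 2"
  unfolding usq_def abs_le_iff by linarith

lemma usq_in_box:
  assumes "inscribed a b c sn" "usq a b c sn x y"
  shows "0 \<le> x" "x \<le> 6" "0 \<le> y" "y \<le> 6"
proof -
  note i = inscribedD[OF assms(1)]
  define f g where "f = (x - a) * c + (y - b) * sn" and "g = (y - b) * c - (x - a) * sn"
  have fg: "\<bar>f\<bar> \<le> 1 / 2" "\<bar>g\<bar> \<le> 1 / 2" using assms(2) by (simp_all add: usq_def f_def g_def)
  have "x - a = (x - a) * (c\<^sup>2 + sn\<^sup>2)" "y - b = (y - b) * (c\<^sup>2 + sn\<^sup>2)" using i(8) by simp_all
  then have xy: "x - a = f * c - g * sn" "y - b = f * sn + g * c"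
    unfolding f_def g_def by algebra+
  have "\<bar>f * c\<bar> \<le> c / 2" "\<bar>f * sn\<bar> \<le> sn / 2" "\<bar>g * c\<bar> \<le> c / 2" "\<bar>g * sn\<bar> \<le> sn / 2"
    using mult_right_mono[OF fg(1) i(6)] mult_right_mono[OF fg(1) i(7)]
      mult_right_mono[OF fg(2) i(6)] mult_right_mono[OF fg(2) i(7)] i(6,7) by (simp_all add: abs_mult)
  then show "0 \<le> x" "x \<le> 6" "0 \<le> y" "y \<le> 6"
    using xy i(2-5) by (auto simp: add_divide_distrib abs_le_iff)
qed

text \<open>This and its three symmetric versions allow points on the boundary of the box to be
  exchanged for points at distance 1 from it.\<close>

lemma usq_left_edge: "inscribed a b c sn \<Longrightarrow> usq a b c sn 0 y \<Longrightarrow> usq a b c sn 1 y"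
  using touch_lemma inscribedD by blast

lemma usq_right_edge: "inscribed a b c sn \<Longrightarrow> usq a b c sn 6 y \<Longrightarrow> usq a b c sn 5 y"
  using usq_left_edge[OF inscribed_reflect, of a b c sn y] usq_reflect[of a b sn c 6 y] usq_reflect[of a b sn c 5 y]
  by simp

lemma usq_bottom_edge: "inscribed a b c sn \<Longrightarrow> usq a b c sn x 0 \<Longrightarrow> usq a b c sn x 1"
  using usq_left_edge[OF inscribed_transpose] usq_transpose by metis

lemma usq_top_edge: "inscribed a b c sn \<Longrightarrow> usq a b c sn x 6 \<Longrightarrow> usq a b c sn x 5"
  using usq_right_edge[OF inscribed_transpose] usq_transpose by metis

lemma convex_usq:
  assumes "c \<ge> 0" "sn \<ge> 0" "usq a b c sn x y1" "usq a b c sn x y2" "y1 \<le> y" "y \<le> y2"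
  shows "usq a b c sn x y"
proof -
  have "(y1 - b) * sn \<le> (y - b) * sn" "(y - b) * sn \<le> (y2 - b) * sn"
    "(y1 - b) * c \<le> (y - b) * c" "(y - b) * c \<le> (y2 - b) * c"
    using assms by (simp_all add: mult_right_mono)
  then show ?thesis using assms(3,4) unfolding usq_def abs_le_iff by linarith
qed

section \<open>Vertical chords of squares near the left side of the box\<close>

text \<open>This is the wall lemma for the left side; the heights 0 and 6, which it may yield, are
  exchanged for 1 and 5.\<close>

lemma column_lemma:
  assumes "inscribed a b c sn" "a \<le> 457 / 500"
  shows "\<exists>k\<in>{1..5::nat}. usq a b c sn (457 / 500) (real k)"
proof -
  note i = inscribedD[OF assms(1)]
  define k where "k = \<lfloor>b\<rfloor>"
  have "1 \<le> c + sn" using direction_bounds(3)[OF i(1)] .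
  then have "1 / 2 \<le> b" "b \<le> 11 / 2" using i(4,5) by (simp_all add: field_simps)
  then have k: "0 \<le> k" "k \<le> 5" unfolding k_def by linarith+
  have kb: "b \<le> of_int k + 1" unfolding k_def by linarith
  have "usq b a sn c (of_int k) (457 / 500) \<or> usq b a sn c (of_int k + 1) (457 / 500)"
    by (rule wall_lemma[OF direction_swap[OF i(1)]]) (use i(2) assms(2) kb in \<open>simp_all add: k_def add.commute\<close>)
  then have kk: "usq a b c sn (457 / 500) (of_int k) \<or> usq a b c sn (457 / 500) (of_int (k + 1))"
    by (simp add: usq_transpose)
  then obtain j :: int where j: "usq a b c sn (457 / 500) (of_int j)" "0 \<le> j" "j \<le> 6"
  proof -
    show thesis
      using kk k that[of k] that[of "k + 1"] by (elim disjE) simp_all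
  qed
  consider "j = 0" | "j = 6" | "1 \<le> j" "j \<le> 5" using j by linarith
  then show ?thesis
  proof cases
    case 1
    then show ?thesis using usq_bottom_edge[OF assms(1)] j by (intro bexI[of _ 1]) auto
  next
    case 2
    then show ?thesis using usq_top_edge[OF assms(1)] j by (intro bexI[of _ 5]) auto
  next
    case 3
    then show ?thesis using j by (intro bexI[of _ "nat j"]) auto
  qed
qed

text \<open>A closed interval of length 1 contains an integer. Rounding up gives at most 5, since y
  + 1 \<le> 6, and 0 is exchanged for 1.\<close>

lemma unit_chord_lemma:
  assumes "inscribed a b c sn" "usq a b c sn x y" "usq a b c sn x (y + 1)"
  shows "\<exists>k\<in>{1..5::nat}. usq a b c sn x (real k)"
proof -
  note i = inscribedD[OF assms(1)]
  define k where "k = \<lceil>y\<rceil>"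
  have y: "0 \<le> y" "y \<le> 5" using usq_in_box[OF assms(1,2)] usq_in_box[OF assms(1,3)] by simp_all
  have k: "y \<le> of_int k" "of_int k \<le> y + 1" "0 \<le> k" "k \<le> 5" using y unfolding k_def by linarith+
  then have *: "usq a b c sn x (of_int k)" using convex_usq[OF i(6,7) assms(2,3)] by simp
  show ?thesis
  proof (cases "k = 0")
    case True
    then show ?thesis using usq_bottom_edge[OF assms(1)] * by (intro bexI[of _ 1]) auto
  next
    case False
    then show ?thesis using * k by (intro bexI[of _ "nat k"]) auto
  qed
qed

text \<open>Near the left corner, a vertical chord at horizontal distance d from the corner has
  length d / (c * sn). Here d = (c + sn) / 2 - (a - x), so the last hypothesis makes this at least
  1.\<close>

lemma unit_chord_exists:
  assumes "c > 0" "sn > 0" "direction c sn" and d: "0 \<le> a - x" "a - x \<le> (c + sn) / 2 - c * sn"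
  shows "\<exists>y. usq a b c sn x y \<and> usq a b c sn x (y + 1)"
proof -
  note ds = direction_bounds[OF assms(3)]
  define e where "e = a - x"
  \<comment> \<open>Heights, relative to the centre, at which the vertical line crosses the lines of
    the two lower sides; \<open>Y\<close> is the lower end of the chord.\<close>
  define L1 L2 where "L1 = (e * c - 1 / 2) / sn" and "L2 = (- (1 / 2) - e * sn) / c"
  define Y where "Y = max L1 L2"
  have one: "e * c\<^sup>2 + e * sn\<^sup>2 = e" using assms(3) by (simp add: direction_def flip: distrib_left)
  have "L1 + 1 \<le> (1 / 2 + e * c) / sn" using ds(2) assms(2) by (simp add: L1_def field_simps)
  moreover have "L2 + 1 \<le> (1 / 2 - e * sn) / c" using ds(1) assms(1) by (simp add: L2_def field_simps)
  moreover have "L1 + 1 \<le> (1 / 2 - e * sn) / c"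
    using d(2) one assms(1,2) by (simp add: L1_def e_def[symmetric] field_simps power2_eq_square)
  moreover have "L2 + 1 \<le> (1 / 2 + e * c) / sn"
  proof -
    have "c * sn \<le> c" using ds(2) assms(1) by simp
    moreover have "c * sn \<le> sn" using ds(1) assms(2) by simp
    ultimately have "c * sn \<le> (c + sn) / 2 + e" using d(1) by (simp add: e_def field_simps)
    then show ?thesis using one assms(1,2) by (simp add: L2_def field_simps power2_eq_square)
  qed
  ultimately have U: "Y + 1 \<le> (1 / 2 + e * c) / sn" "Y + 1 \<le> (1 / 2 - e * sn) / c" by (auto simp: Y_def)
  have L: "(e * c - 1 / 2) / sn \<le> Y" "(- (1 / 2) - e * sn) / c \<le> Y" by (auto simp: Y_def L1_def L2_def)
  have "- (1 / 2) \<le> Y * sn - e * c" "Y * sn + sn - e * c \<le> 1 / 2" "- (1 / 2) \<le> Y * c + e * sn" "Y * c + c + e * sn \<le> 1 / 2"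
    using U L assms(1,2) by (simp_all add: field_simps)
  moreover have "b + Y - b = Y" "b + Y + 1 - b = Y + 1" by simp_all
  ultimately have "usq a b c sn x (b + Y) \<and> usq a b c sn x (b + Y + 1)"
    using assms(1,2) unfolding usq_iff e_def by (simp add: left_diff_distrib distrib_right)
  then show ?thesis by blast
qed

text \<open>The chord on x = 457 / 500 is shorter than 1, the one on x = 1 / 2 has length at least
  79 / 500. Together this gives c * sn > 49 / 100, a tilt near 45 degrees, and confines the square
  so much that the third point lies inside.\<close>

lemma slanted_lemma:
  assumes ins: "inscribed a b c sn" and a: "457 / 500 < a"
    and pts: "usq a b c sn (1 / 2) m" "usq a b c sn (1 / 2) (m + 79 / 500)"
    and col: "\<forall>k\<in>{1..5::nat}. \<not> usq a b c sn (457 / 500) (real k)"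
  shows "usq a b c sn (3 / 2) m"
proof -
  note i = inscribedD[OF ins] note d = direction_bounds[OF i(1)]
  have no: "\<not> (usq a b c sn (457 / 500) y \<and> usq a b c sn (457 / 500) (y + 1))" for y
    using unit_chord_lemma[OF ins] col by blast
  have "sn \<noteq> 0"
  proof
    assume "sn = 0"
    then have "c = 1" using i(6,8) by (simp add: power2_eq_1_iff)
    then show False using no[of "b - 1 / 2"] pts(1) a \<open>sn = 0\<close> by (auto simp: usq_def abs_le_iff)
  qed
  moreover have "c \<noteq> 0"
  proof
    assume "c = 0"
    then have "sn = 1" using i(7,8) by (simp add: power2_eq_1_iff)
    then show False using no[of "b - 1 / 2"] pts(1) a \<open>c = 0\<close> by (auto simp: usq_def abs_le_iff)
  qed
  ultimately have pos: "c > 0" "sn > 0" using i(6,7) by simp_all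
  define h D Y where "h = (c + sn) / 2" and "D = a - 1 / 2" and "Y = m - b"
  \<comment> \<open>207 / 500 = 457 / 500 - 1 / 2.\<close>
  have hd: "h - c * sn < D - 207 / 500"
  proof -
    have "\<not> a - 457 / 500 \<le> (c + sn) / 2 - c * sn"
      using unit_chord_exists[OF pos i(1), of a "457 / 500" b] no a by fastforce
    then show ?thesis by (simp add: h_def D_def)
  qed
  have f: "- (1 / 2) \<le> Y * sn - D * c" and g: "(Y + 79 / 500) * c + D * sn \<le> 1 / 2"
    using pts by (simp_all add: usq_iff D_def Y_def algebra_simps)
  have "sn * ((Y + 79 / 500) * c + D * sn) - c * (Y * sn - D * c) = 79 / 500 * (c * sn) + D * (c\<^sup>2 + sn\<^sup>2)"
    by (simp add: algebra_simps power2_eq_square)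
  moreover have "sn * ((Y + 79 / 500) * c + D * sn) \<le> sn * (1 / 2)" "c * - (1 / 2) \<le> c * (Y * sn - D * c)"
    using f g pos by (intro mult_left_mono; simp)+
  ultimately have D: "D \<le> h - 79 / 500 * (c * sn)" using i(8) by (simp add: h_def add_divide_distrib)
  have cs: "c * sn > 49 / 100" using D hd by linarith
  have h2: "h\<^sup>2 = 1 / 4 + c * sn / 2" using d(6) by (simp add: h_def power_divide field_simps)
  have "(351 / 500)\<^sup>2 \<le> h\<^sup>2" unfolding h2 using cs by (simp add: power2_eq_square)
  then have hl: "351 / 500 \<le> h" by (rule power2_le_imp_le) (use pos in \<open>simp add: h_def\<close>)
  have "h\<^sup>2 \<le> (71 / 100)\<^sup>2" unfolding h2 using d(5) by (simp add: power2_eq_square)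
  then have hu: "h \<le> 71 / 100" by (rule power2_le_imp_le) simp
  have "(c - sn)\<^sup>2 = 1 - 2 * (c * sn)" using i(8) by (simp add: power2_diff)
  then have "(c - sn)\<^sup>2 \<le> (71 / 500)\<^sup>2" using cs unfolding power2_eq_square by linarith
  then have "\<bar>c - sn\<bar> \<le> 71 / 500" by (intro power2_le_imp_le[of "\<bar>c - sn\<bar>"]) simp_all
  moreover have "c + sn = 2 * h" by (simp add: h_def)
  ultimately have c: "63 / 100 \<le> c" "c \<le> 79 / 100" and sn: "63 / 100 \<le> sn" "sn \<le> 79 / 100"
    using hl hu unfolding abs_le_iff by linarith+
  have Dl: "77 / 125 \<le> D" using hd hl d(5) by linarith
  have Du: "D \<le> 16 / 25" using D hu cs by linarith
  have Dc: "77 / 125 * (63 / 100) \<le> D * c" "77 / 125 * (63 / 100) \<le> D * sn"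
    using mult_mono[of "77 / 125" D "63 / 100" c] mult_mono[of "77 / 125" D "63 / 100" sn] Dl c(1) sn(1) by linarith+
  have Yl: "- (19 / 100) \<le> Y"
  proof (rule ccontr)
    assume "\<not> ?thesis"
    then have "Y * sn < - (19 / 100) * sn" using mult_strict_right_mono[of Y "- (19 / 100)" sn] pos by linarith
    moreover have "19 / 100 * (63 / 100) \<le> 19 / 100 * sn" using sn(1) by linarith
    ultimately show False using f Dc by linarith
  qed
  have Yu: "Y \<le> 19 / 100"
  proof (rule ccontr)
    assume "\<not> ?thesis"
    then have "19 / 100 \<le> Y + 79 / 500" by linarith
    then have "(19 / 100) * (63 / 100) \<le> (Y + 79 / 500) * c" using c(1) mult_mono[of "19 / 100" "Y + 79 / 500" "63 / 100" c] by linarith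
    then show False using g Dc by linarith
  qed
  \<comment> \<open>Relative to the centre, the point to be caught is (1 - D, Y), with 1 - D \<le>
    48 / 125.\<close>
  have bd: "\<bar>(1 - D) * r\<bar> \<le> 48 / 125 * (79 / 100)" "\<bar>Y * r\<bar> \<le> 19 / 100 * (79 / 100)" if "0 \<le> r" "r \<le> 79 / 100" for r
    unfolding abs_mult using that Dl Du Yl Yu by (intro mult_mono; simp add: abs_le_iff)+
  have "\<bar>(1 - D) * c\<bar> \<le> 79 / 250" "\<bar>Y * sn\<bar> \<le> 4 / 25" "\<bar>Y * c\<bar> \<le> 4 / 25" "\<bar>(1 - D) * sn\<bar> \<le> 79 / 250"
    using bd[of c] bd[of sn] c sn by simp_all
  then have "\<bar>(1 - D) * c + Y * sn\<bar> \<le> 1 / 2" "\<bar>Y * c - (1 - D) * sn\<bar> \<le> 1 / 2"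
    using abs_triangle_ineq[of "(1 - D) * c" "Y * sn"] abs_triangle_ineq4[of "Y * c" "(1 - D) * sn"] by linarith+
  then show ?thesis by (simp add: usq_def D_def Y_def)
qed

text \<open>If both points are missed, \<open>tall_chord_aux\<close> and its mirror image put the
  chord on x = 1 strictly between them. It is then shorter than 177 / 250 = 433 / 500 - 79 / 500,
  too short for a square to the right of x = 0.\<close>

lemma tall_chord_lemma:
  assumes ins: "inscribed a b c sn" and pts: "usq a b c sn (1 / 2) m" "usq a b c sn (1 / 2) (m + 128 / 125)"
  shows "usq a b c sn 1 (m + 79 / 500) \<or> usq a b c sn 1 (m + 433 / 500)"
proof (rule ccontr)
  assume neg: "\<not> ?thesis"
  note i = inscribedD[OF ins] note d = direction_bounds[OF i(1)]
  define Y h where "Y = m - b" and "h = (c + sn) / 2"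
  have P1: "- (1 / 2) \<le> (1 / 2 - a) * c + Y * sn" "- (1 / 2) \<le> Y * c - (1 / 2 - a) * sn"
    using pts(1) unfolding usq_def Y_def abs_le_iff by linarith+
  have P2: "(1 / 2 - a) * c + (Y + 128 / 125) * sn \<le> 1 / 2" "(Y + 128 / 125) * c - (1 / 2 - a) * sn \<le> 1 / 2"
    using pts(2) by (simp_all add: usq_iff Y_def algebra_simps)
  have lt: "c < 1" "sn < 1" using P1 P2 by (simp_all add: algebra_simps)
  have "c \<noteq> 0" "sn \<noteq> 0" using lt d(3) by auto
  then have pos: "c > 0" "sn > 0" using i(6,7) by simp_all
  have A: "(1 - a) * c + (Y + 79 / 500) * sn \<le> 1 / 2"
    using tall_chord_aux[OF pos i(8) i(2) P2, of Y] by simp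
  \<comment> \<open>Reflection in a horizontal line exchanges \<open>c\<close> with
    \<open>sn\<close> and negates heights.\<close>
  have B: "(1 - a) * sn - (Y + 433 / 500) * c \<le> 1 / 2"
    using tall_chord_aux[of sn c a "- Y" "- Y - 128 / 125"] pos i(2,8) P1 by (simp add: algebra_simps)
  have mono: "Y * c \<le> (Y + 79 / 500) * c" "(Y + 79 / 500) * c \<le> (Y + 433 / 500) * c" "(Y + 433 / 500) * c \<le> (Y + 128 / 125) * c"
     "Y * sn \<le> (Y + 79 / 500) * sn" "(Y + 79 / 500) * sn \<le> (Y + 433 / 500) * sn" "(Y + 433 / 500) * sn \<le> (Y + 128 / 125) * sn"
    using pos by simp_all
  have split: "(1 - a) * c = (1 / 2 - a) * c + c / 2" "(1 - a) * sn = (1 / 2 - a) * sn + sn / 2" by (simp_all add: field_simps)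
  have "\<not> (\<bar>(1 - a) * c + (Y + 79 / 500) * sn\<bar> \<le> 1 / 2 \<and> \<bar>(Y + 79 / 500) * c - (1 - a) * sn\<bar> \<le> 1 / 2)"
    using neg by (simp add: usq_def Y_def algebra_simps)
  then have B': "(1 - a) * sn - (Y + 79 / 500) * c > 1 / 2"
    using A P1 P2 mono split pos unfolding abs_le_iff by linarith
  have "\<not> (\<bar>(1 - a) * c + (Y + 433 / 500) * sn\<bar> \<le> 1 / 2 \<and> \<bar>(Y + 433 / 500) * c - (1 - a) * sn\<bar> \<le> 1 / 2)"
    using neg by (simp add: usq_def Y_def algebra_simps)
  then have A': "(1 - a) * c + (Y + 433 / 500) * sn > 1 / 2"
    using B P1 P2 mono split pos unfolding abs_le_iff by linarith
  have "c * ((1 - a) * c + (Y + 433 / 500) * sn) > c * (1 / 2)" "sn * ((1 - a) * sn - (Y + 79 / 500) * c) > sn * (1 / 2)"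
    using A' B' pos by simp_all
  moreover have "c * ((1 - a) * c + (Y + 433 / 500) * sn) + sn * ((1 - a) * sn - (Y + 79 / 500) * c)
      = (c\<^sup>2 + sn\<^sup>2) - a * (c\<^sup>2 + sn\<^sup>2) + 177 / 250 * (c * sn)"
    by (simp add: algebra_simps power2_eq_square)
  ultimately have "h < 1 - a + 177 / 250 * (c * sn)" using i(8) by (simp add: h_def)
  then have 1: "2 * h - 1 < 177 / 250 * (c * sn)" using i(2)[folded h_def] by linarith
  have "h\<^sup>2 \<le> (71 / 100)\<^sup>2" using d(4) by (simp add: h_def power_divide power2_eq_square)
  then have hu: "h \<le> 71 / 100" by (rule power2_le_imp_le) simp
  have "2 * h = c + sn" by (simp add: h_def)
  then have "2 * (c * sn) = (2 * h)\<^sup>2 - 1" using d(6) by simp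
  also have "\<dots> = (2 * h - 1) * (2 * h + 1)" by (simp add: power2_eq_square algebra_simps)
  also have "\<dots> \<le> (2 * h - 1) * (121 / 50)" using hu d(3) by (intro mult_left_mono) (simp_all add: h_def)
  finally have "2 * (c * sn) \<le> (2 * h - 1) * (121 / 50)" .
  moreover have "c * sn > 0" using pos by simp
  moreover have "(2 * h - 1) * (121 / 50) \<le> 177 / 250 * (c * sn) * (121 / 50)"
    using 1 by (intro mult_right_mono) simp_all
  ultimately show False by linarith
qed

section \<open>The two unavoidable sets of 33 points\<close>

text \<open>The label \<open>(k, i)\<close> stands for the point with abscissa \<open>k / 2\<close>
  in row \<open>i\<close>. Fixing the parity of \<open>k + i\<close> makes rows of integers and of
  half-integers alternate; the two values of \<open>e\<close> give the set and its mirror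
  image.\<close>

definition labels :: "bool \<Rightarrow> (nat \<times> nat) set" where
  "labels e = {(k, i). 1 \<le> k \<and> k \<le> 11 \<and> i < 6 \<and> even (k + i) = e}"
lemma card_labels: "finite (labels e)" "card (labels e) = 33"
proof -
  define col row where "col e = {k::nat. 1 \<le> k \<and> k \<le> 11 \<and> even k = e}" and "row e = {i::nat. i < 6 \<and> even i = e}" for e
  have col: "col True = {2,4,6,8,10}" "col False = {1,3,5,7,9,11}"
    unfolding col_def by (auto, presburger+)
  have row: "row True = {0,2,4}" "row False = {1,3,5}"
    unfolding row_def by (auto, presburger+)
  have "labels e = col True \<times> row e \<union> col False \<times> row (\<not> e)"
    by (auto simp: labels_def col_def row_def)
  moreover have "(col True \<times> row e) \<inter> (col False \<times> row (\<not> e)) = {}"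
    by (auto simp: col_def)
  moreover have "card (col True) = 5" "card (col False) = 6"
    by (simp_all add: col)
  moreover have "card (row e) = 3" for e by (cases e) (simp_all add: row)
  moreover have "finite (col e)" "finite (row e)" for e by (simp_all add: col_def row_def)
  ultimately show "finite (labels e)" "card (labels e) = 33"
    by (simp_all add: card_Un_disjoint card_cartesian_product)
qed

text \<open>The gap 433/500 is just below \<open>sqrt 3 / 2\<close>, so that neighbouring points of adjacent rows have distance
  at most 1, and 189/250 + 79/500 = 457/500 is just below \<open>sqrt 2 - 1/2\<close>, the greatest height for which
  the wall lemma holds. By symmetry the top row has to stay above 6 - 457/500 = 189/250 + 5 * 433/500, which
  leaves exactly the interval \<open>0 \<le> t \<le> 79/500\<close>.\<close>

definition ht :: "nat \<Rightarrow> real \<Rightarrow> real" where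
  "ht i t = 189 / 250 + 433 / 500 * real i + t"

lemma ht_Suc: "ht (Suc i) t = ht i t + 433 / 500"
  by (simp add: ht_def field_simps)

lemma ht_add: "ht i t + u = ht i (t + u)"
  by (simp add: ht_def)

text \<open>Translates the rows of \<open>strip_lemma\<close>, offset by 1 / 2 from each other, into
  half-integers with the parity required by \<open>labels e\<close>.\<close>

lemma lattice_row:
  fixes i :: nat
  obtains x0 :: real and k0 :: int
  where "\<And>j. x0 + of_int j = of_int (k0 + 2 * j) / 2" "\<And>j. x0 + 1 / 2 + of_int j = of_int (k0 + 2 * j + 1) / 2"
    "\<And>j. even (k0 + 2 * j + int i) = e" "\<And>j. even (k0 + 2 * j + 1 + int (Suc i)) = e"
proof -
  define k0 where "k0 = (if even i = e then 0 else 1 :: int)"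
  show thesis by (rule that[of "of_int k0 / 2" k0]) (auto simp: add_divide_distrib k0_def)
qed

text \<open>The rows are infinite here. Centres below the lowest row are handled by the wall lemma,
  those above the highest by its reflection, all others by the strip lemma.\<close>

lemma unavoidable_infinite:
  assumes ins: "inscribed a b c sn" and t: "0 \<le> t" "t \<le> 79 / 500"
  shows "\<exists>i<6. \<exists>k::int. even (k + int i) = e \<and> usq a b c sn (of_int k / 2) (ht i t)"
proof -
  note i = inscribedD[OF ins]
  have wall: "\<exists>j. usq a' b' c' sn' (x0 + of_int j) \<eta>"
    if "direction c' sn'" "(c' + sn') / 2 \<le> b'" "b' \<le> \<eta>" "\<eta> \<le> 457 / 500" for a' b' c' sn' x0 \<eta>
  proof -
    have "x0 + of_int \<lfloor>a' - x0\<rfloor> \<le> a'" "a' \<le> x0 + of_int \<lfloor>a' - x0\<rfloor> + 1" by linarith+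
    from wall_lemma[OF that this] show ?thesis
      by (metis add.assoc of_int_1 of_int_add)
  qed
  consider (low) "b \<le> ht 0 t" | (mid) j where "j < 5" "ht j t \<le> b" "b \<le> ht (Suc j) t" | (high) "ht 5 t \<le> b"
  proof -
    have "\<exists>j<n. ht j t \<le> b \<and> b \<le> ht (Suc j) t" if "ht 0 t \<le> b" "b \<le> ht n t" "n > 0" for n
      using that
    proof (induction n)
      case (Suc n)
      then show ?case by (cases "n = 0"; cases "b \<le> ht n t") (auto intro: less_SucI)
    qed simp
    from this[of 5] show thesis using that by (meson linorder_le_cases zero_less_numeral)
  qed
  then show ?thesis
  proof cases
    case low
    obtain x0 k0 where k0: "\<And>j. x0 + of_int j = of_int (k0 + 2 * j) / (2::real)" "\<And>j. even (k0 + 2 * j + int 0) = e"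
      using lattice_row[of 0 e] by metis
    obtain j where "usq a b c sn (x0 + of_int j) (ht 0 t)"
      using wall[OF i(1,4) low] t by (auto simp: ht_def)
    then show ?thesis using k0 by (metis zero_less_numeral)
  next
    case high
    obtain x0 k0 where k0: "\<And>j. x0 + of_int j = of_int (k0 + 2 * j) / (2::real)" "\<And>j. even (k0 + 2 * j + int 5) = e"
      using lattice_row[of 5 e] by metis
    have "(sn + c) / 2 \<le> 6 - b" using i(5) by (simp add: field_simps)
    then have "\<exists>j. usq a (6 - b) sn c (x0 + of_int j) (6 - ht 5 t)"
      by (rule wall[OF direction_swap[OF i(1)]]) (use high t in \<open>simp_all add: ht_def\<close>)
    then obtain j where "usq a b c sn (x0 + of_int j) (ht 5 t)"
      by (auto simp: usq_reflect')
    moreover have "(5::nat) < 6" by simp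
    ultimately show ?thesis using k0 by metis
  next
    case mid
    obtain x0 k0 where k0: "\<And>j. x0 + of_int j = of_int (k0 + 2 * j) / (2::real)"
      "\<And>j. x0 + 1 / 2 + of_int j = of_int (k0 + 2 * j + 1) / 2"
      "\<And>j'. even (k0 + 2 * j' + int j) = e" "\<And>j'. even (k0 + 2 * j' + 1 + int (Suc j)) = e"
      by (rule lattice_row[of j e]) (rule that; assumption)
    have lt: "j < 6" "Suc j < 6" using mid by simp_all
    obtain k where "usq a b c sn (x0 + of_int k) (ht j t) \<or> usq a b c sn (x0 + 1 / 2 + of_int k) (ht (Suc j) t)"
      using strip_lemma[OF i(1) mid(2), of a x0] mid(3) by (auto simp: ht_Suc)
    then show ?thesis using k0 lt by metis
  qed
qed

lemma unavoidable:
  assumes ins: "inscribed a b c sn" and t: "0 \<le> t" "t \<le> 79 / 500"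
  shows "\<exists>(k, i) \<in> labels e. usq a b c sn (real k / 2) (ht i t)"
proof -
  obtain i and k :: int where i: "i < 6" and k: "even (k + int i) = e" "usq a b c sn (of_int k / 2) (ht i t)"
    using unavoidable_infinite[OF assms] by blast
  have "0 \<le> k" "k \<le> 12" using usq_in_box(1,2)[OF ins k(2)] by linarith+
  \<comment> \<open>Only abscissae 0 and 6 have to be removed; moving them inwards by 1 changes
    \<open>k\<close> by 2 and keeps its parity.\<close>
  then consider "k = 0" | "k = 12" | "1 \<le> k" "k \<le> 11" by linarith
  then have "\<exists>k'. 1 \<le> k' \<and> k' \<le> 11 \<and> even (k' + int i) = e \<and> usq a b c sn (of_int k' / 2) (ht i t)"
  proof cases
    case 1
    then show ?thesis using usq_left_edge[OF ins] k by (intro exI[of _ 2]) auto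
  next
    case 2
    then show ?thesis using usq_right_edge[OF ins] k by (intro exI[of _ 10]) auto
  next
    case 3
    then show ?thesis using k by blast
  qed
  then obtain k' where k': "1 \<le> k'" "k' \<le> 11" "even (k' + int i) = e" "usq a b c sn (of_int k' / 2) (ht i t)"
    by blast
  have "int (nat k' + i) = k' + int i" using k' by simp
  then have "even (nat k' + i) = e" using k'(3) by (metis even_of_nat)
  then have "(nat k', i) \<in> labels e" "usq a b c sn (real (nat k') / 2) (ht i t)"
    using i k' by (simp_all add: labels_def nat_le_iff le_nat_iff)
  then show ?thesis by blast
qed

section \<open>Counting points in 33 disjoint squares\<close>

text \<open>A packing in a square of side less than 6 would lead to this situation, which is refuted
  at the end of the locale. Disjointness concerns the closed squares.\<close>

locale disjoint_squares =
  fixes a b c sn :: "nat \<Rightarrow> real"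
  assumes inscribed: "n < 33 \<Longrightarrow> inscribed (a n) (b n) (c n) (sn n)"
    and disjoint: "\<lbrakk>n < 33; n' < 33; usq (a n) (b n) (c n) (sn n) x y; usq (a n') (b n') (c n') (sn n') x y\<rbrakk> \<Longrightarrow> n = n'"
begin

definition hit :: "nat \<Rightarrow> nat \<times> nat \<Rightarrow> real \<Rightarrow> bool" where
  "hit n l t \<longleftrightarrow> usq (a n) (b n) (c n) (sn n) (real (fst l) / 2) (ht (snd l) t)"

lemma hit_exists:
  assumes "n < 33" "0 \<le> t" "t \<le> 79 / 500"
  obtains l where "l \<in> labels e" "hit n l t"
  using unavoidable[OF inscribed[OF assms(1)] assms(2,3), of e] by (auto simp: hit_def)

text \<open>Choosing a point in each square injects 33 squares into 33 labels, hence is onto. A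
  second point in a square would be the chosen point of another square, against
  disjointness.\<close>

lemma hit_unique:
  assumes n: "n < 33" and t: "0 \<le> t" "t \<le> 79 / 500" and l: "l \<in> labels e" "l' \<in> labels e" "hit n l t" "hit n l' t"
  shows "l = l'"
proof -
  define f where "f n = (SOME l. l \<in> labels e \<and> hit n l t)" for n
  have f: "f m \<in> labels e" "hit m (f m) t" if "m < 33" for m
    using someI_ex[of "\<lambda>l. l \<in> labels e \<and> hit m l t"] hit_exists[OF that t, of e] unfolding f_def by blast+
  have "inj_on f {..<33}"
    using f disjoint unfolding inj_on_def hit_def by (metis lessThan_iff)
  then have "card (f ` {..<33}) = card (labels e)" by (simp add: card_image card_labels)
  then have "f ` {..<33} = labels e" using f card_labels(1) by (intro card_subset_eq) auto
  then obtain m m' where "l = f m" "m < 33" "l' = f m'" "m' < 33" using l by blast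
  then show ?thesis using f l n disjoint unfolding hit_def by metis
qed

text \<open>As the point set moves upwards, the sets of times at which a square contains the individual
  points form a partition of the time interval into finitely many closed sets.\<close>

lemma hit_constant:
  assumes n: "n < 33" and t: "t \<in> {0..79 / 500}" "t' \<in> {0..79 / 500}" and l: "l \<in> labels e" "hit n l t"
  shows "hit n l t'"
proof (rule ccontr)
  assume neg: "\<not> hit n l t'"
  have cl: "closed {u. hit n m u}" for m
    unfolding hit_def usq_def ht_def by (intro closed_Collect_conj closed_Collect_le continuous_intros)
  define B where "B = (\<Union>m\<in>labels e - {l}. {u. hit n m u})"
  have "closed B" unfolding B_def using card_labels(1) cl by (intro closed_UN) auto
  moreover have "{0..79 / 500} \<subseteq> {u. hit n l u} \<union> B"
  proof
    fix u :: real
    assume "u \<in> {0..79 / 500}"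
    then obtain m where "m \<in> labels e" "hit n m u" using hit_exists[OF n, of u e] by auto
    then show "u \<in> {u. hit n l u} \<union> B" by (cases "m = l") (auto simp: B_def)
  qed
  moreover have "{u. hit n l u} \<inter> B \<inter> {0..79 / 500} = {}"
    using hit_unique[OF n _ _ _ l(1)] by (auto simp: B_def)
  moreover have "{u. hit n l u} \<inter> {0..79 / 500} \<noteq> {}" using l t by blast
  moreover have "B \<inter> {0..79 / 500} \<noteq> {}"
    using neg t(2) \<open>{0..79 / 500} \<subseteq> {u. hit n l u} \<union> B\<close> by blast
  ultimately show False
    using connected_closed[THEN iffD1, OF connected_Icc[of 0 "79 / 500 :: real"]] cl[of l] by blast
qed

text \<open>By \<open>hit_constant\<close> the square contains the lower point at time 0 and the
  upper one at time 79 / 500, which are at least 128 / 125 apart. The point then supplied by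
  \<open>tall_chord_lemma\<close> is, at one of these times, a second point of one of the two
  sets.\<close>

lemma left_edge_labels:
  assumes n: "n < 33" and h: "hit n (1, i) 0" "hit n (1, j) 0" "i < 6" "j < 6" "even i \<noteq> even j"
  shows False
proof -
  have False if ij: "i < j" and h: "hit n (1, i) 0" "hit n (1, j) 0" "j < 6" "even i \<noteq> even j" for i j
  proof -
    let ?U = "usq (a n) (b n) (c n) (sn n)"
    note ins = inscribedD[OF inscribed[OF n]]
    have l: "(1, i) \<in> labels (odd i)" "(1, j) \<in> labels (odd j)"
      using that by (auto simp: labels_def)
    have lo: "?U (1 / 2) (ht i 0)" using h(1) by (simp add: hit_def)
    have "hit n (1, j) (79 / 500)" by (rule hit_constant[OF n _ _ l(2) h(2)]) simp_all
    then have hi: "?U (1 / 2) (ht j (79 / 500))" by (simp add: hit_def)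
    have "ht i 0 + 128 / 125 \<le> ht j (79 / 500)" using ij by (simp add: ht_def)
    then have top: "?U (1 / 2) (ht i 0 + 128 / 125)" using convex_usq[OF ins(6,7) lo hi] by simp
    from tall_chord_lemma[OF inscribed[OF n] lo top]
    have "?U 1 (ht i (79 / 500)) \<or> ?U 1 (ht (Suc i) 0)" by (simp add: ht_add ht_Suc)
    moreover have "\<not> ?U 1 (ht i (79 / 500))"
    proof
      assume "?U 1 (ht i (79 / 500))"
      then have "hit n (2, i) (79 / 500)" by (simp add: hit_def)
      moreover have "(2, i) \<in> labels (even i)" "(1, j) \<in> labels (even i)" using that by (auto simp: labels_def)
      ultimately show False using hit_unique[OF n _ _ _ _ _ \<open>hit n (1, j) (79 / 500)\<close>] by fastforce
    qed
    moreover have "\<not> ?U 1 (ht (Suc i) 0)"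
    proof
      assume "?U 1 (ht (Suc i) 0)"
      then have "hit n (2, Suc i) 0" by (simp add: hit_def)
      moreover have "(2, Suc i) \<in> labels (odd i)" using that by (auto simp: labels_def)
      ultimately show False using hit_unique[OF n _ _ _ l(1) _ h(1)] by fastforce
    qed
    ultimately show False by blast
  qed
  then show False using h by (metis linorder_neqE_nat)
qed

text \<open>The two label sets together are the 66 pairs with \<open>k\<close> in {1..11} and
  \<open>i < 6\<close>. Trading the six with \<open>k = 1\<close> for five column points leaves 65 =
  2 * 33 - 1.\<close>

definition Z :: "(real \<times> real) set" where
  "Z = (\<lambda>(k, i). (real k / 2, ht i 0)) ` ({2..11} \<times> {..<6}) \<union> (\<lambda>k. (457 / 500, real k)) ` {1..5}"

lemma card_Z: "finite Z" "card Z \<le> 65"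
proof -
  show "finite Z" by (simp add: Z_def)
  have "card Z \<le> card ((\<lambda>(k, i). (real k / 2, ht i 0)) ` ({2..11} \<times> {..<6::nat})) + card ((\<lambda>k. (457 / 500 :: real, real k)) ` {1..5})"
    unfolding Z_def by (rule card_Un_le)
  also have "\<dots> \<le> card ({2..11::nat} \<times> {..<6::nat}) + card {1..5::nat}"
    by (intro add_mono card_image_le) simp_all
  finally show "card Z \<le> 65" by simp
qed

lemma two_points_of_Z:
  assumes n: "n < 33"
  shows "\<exists>p\<in>Z. \<exists>q\<in>Z. p \<noteq> q \<and> usq (a n) (b n) (c n) (sn n) (fst p) (snd p) \<and> usq (a n) (b n) (c n) (sn n) (fst q) (snd q)"
proof -
  let ?U = "usq (a n) (b n) (c n) (sn n)"
  note ins = inscribedD[OF inscribed[OF n]]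
  have ht_inj: "i = j" if "ht i 0 = ht j 0" for i j using that by (simp add: ht_def)
  obtain l where l: "l \<in> labels True" "hit n l 0" using hit_exists[OF n, of 0 True] by auto
  obtain m where m: "m \<in> labels False" "hit n m 0" using hit_exists[OF n, of 0 False] by auto
  have "l \<noteq> m" using l m by (auto simp: labels_def)
  have Zl: "(real k / 2, ht i 0) \<in> Z" if "(k, i) \<in> labels e" "k \<noteq> 1" for k i e
  proof -
    have "(k, i) \<in> {2..11} \<times> {..<6}" using that by (auto simp: labels_def)
    then show ?thesis unfolding Z_def by (intro UnI1 image_eqI[of _ _ "(k, i)"]) simp_all
  qed
  \<comment> \<open>When one of the two points has abscissa 1 / 2 and is therefore absent from
    \<open>Z\<close>, a column point takes its place.\<close>
  have one: ?thesis if ki: "(1, i) \<in> labels e" "hit n (1, i) 0" and l': "(k', i') \<in> labels (\<not> e)" "hit n (k', i') 0" "k' \<noteq> 1"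
    for i e k' i'
  proof -
    have "\<exists>k\<in>{1..5::nat}. ?U (457 / 500) (real k)"
    proof (cases "a n \<le> 457 / 500")
      case True
      then show ?thesis using column_lemma inscribed[OF n] by blast
    next
      case False
      show ?thesis
      proof (rule ccontr)
        assume neg: "\<not> ?thesis"
        have "hit n (1, i) (79 / 500)" by (rule hit_constant[OF n _ _ ki]) simp_all
        then have "?U (1 / 2) (ht i 0 + 79 / 500)" "?U (1 / 2) (ht i 0)"
          using ki(2) by (simp_all add: hit_def ht_def)
        then have "?U (3 / 2) (ht i 0)"
          using slanted_lemma[OF inscribed[OF n], of "ht i 0"] False neg by simp
        then have "hit n (3, i) 0" by (simp add: hit_def)
        moreover have "(3, i) \<in> labels e" using ki by (auto simp: labels_def)
        ultimately show False using hit_unique[OF n _ _ ki(1) _ ki(2)] by fastforce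
      qed
    qed
    then obtain k :: nat where k: "k \<in> {1..5}" "?U (457 / 500) (real k)" by blast
    have "(457 / 500, real k) \<in> Z" using k by (auto simp: Z_def)
    moreover have "(real k' / 2, ht i' 0) \<in> Z" using Zl l' by blast
    \<comment> \<open>The column point is new because 457 / 500 is not a multiple of 1 / 2.\<close>
    moreover have "real k' / 2 \<noteq> 457 / 500"
    proof
      assume "real k' / 2 = 457 / 500"
      then have "real (250 * k') = real 457" by (simp add: field_simps)
      then have "250 * k' = 457" by (simp only: of_nat_eq_iff)
      then show False by presburger
    qed
    ultimately show ?thesis
      using k(2) l'(2) unfolding hit_def
      by (intro bexI[of _ "(real k' / 2, ht i' 0)"] bexI[of _ "(457 / 500, real k)"]) simp_all
  qed
  obtain k i where lki: "l = (k, i)" by fastforce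
  obtain k' i' where mki: "m = (k', i')" by fastforce
  show ?thesis
  proof (cases "k = 1")
    case True
    show ?thesis
    proof (cases "k' = 1")
      case True
      then have False using left_edge_labels[OF n, of i i'] l m lki mki \<open>k = 1\<close> by (auto simp: labels_def)
      then show ?thesis ..
    next
      case False
      then show ?thesis using one[of i True k' i'] l m lki mki True by simp
    qed
  next
    case False
    show ?thesis
    proof (cases "k' = 1")
      case True
      then show ?thesis using one[of i' False k i] l m lki mki False by simp
    next
      case k': False
      have "(real k / 2, ht i 0) \<noteq> (real k' / 2, ht i' 0)" using \<open>l \<noteq> m\<close> ht_inj lki mki by auto
      then show ?thesis using l(2) m(2) Zl[of k i True] Zl[of k' i' False] l(1) m(1) False k'
        unfolding lki mki hit_def
        by (intro bexI[of _ "(real k / 2, ht i 0)"] bexI[of _ "(real k' / 2, ht i' 0)"]) simp_all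
    qed
  qed
qed

lemma no_33_disjoint_squares: False
proof -
  define P where "P n = {p \<in> Z. usq (a n) (b n) (c n) (sn n) (fst p) (snd p)}" for n
  have fin: "finite (P n)" for n by (simp add: P_def card_Z)
  have "2 \<le> card (P n)" if n: "n < 33" for n
  proof -
    obtain p q where "p \<in> P n" "q \<in> P n" "p \<noteq> q" using two_points_of_Z[OF n] by (auto simp: P_def)
    then have "card {p, q} \<le> card (P n)" using fin by (intro card_mono) auto
    then show ?thesis using \<open>p \<noteq> q\<close> by simp
  qed
  then have "(\<Sum>n<33::nat. 2) \<le> (\<Sum>n<33. card (P n))" by (intro sum_mono) auto
  also have "\<dots> = card (\<Union>n<33. P n)"
    using disjoint fin by (subst card_UN_disjoint) (auto simp: P_def)
  also have "\<dots> \<le> card Z" by (rule card_mono) (auto simp: P_def card_Z)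
  also have "\<dots> \<le> 65" by (rule card_Z)
  finally show False by simp
qed

end

section \<open>Frames in the plane and the passage to coordinates\<close>

text \<open>The determinant \<open>D\<close> is 1 or -1, and \<open>v\<close> is \<open>D\<close>
  times the quarter turn of \<open>u\<close>; the rest is algebra in components.\<close>

lemma frame_expand:
  assumes "orthonormal_frame u v"
  shows "(w \<bullet> u) *\<^sub>R u + (w \<bullet> v) *\<^sub>R v = w"
proof -
  have u: "u $ 1 * u $ 1 + u $ 2 * u $ 2 = 1" and v: "v $ 1 * v $ 1 + v $ 2 * v $ 2 = 1"
    and uv: "u $ 1 * v $ 1 + u $ 2 * v $ 2 = 0"
    using assms by (simp_all add: orthonormal_frame_def norm_eq_1 inner_vec_def sum_2)
  define D where "D = u $ 1 * v $ 2 - u $ 2 * v $ 1"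
  have v1: "v $ 1 = - D * u $ 2" and v2: "v $ 2 = D * u $ 1"
    unfolding D_def using u uv by algebra+
  have "D * D = 1" unfolding D_def using u v uv by algebra
  then have "u $ 1 * u $ 1 + v $ 1 * v $ 1 = 1" "u $ 2 * u $ 2 + v $ 2 * v $ 2 = 1" "u $ 1 * u $ 2 + v $ 1 * v $ 2 = 0"
    unfolding v1 v2 using u by algebra+
  then have "(w $ 1 * u $ 1 + w $ 2 * u $ 2) * u $ 1 + (w $ 1 * v $ 1 + w $ 2 * v $ 2) * v $ 1 = w $ 1"
    "(w $ 1 * u $ 1 + w $ 2 * u $ 2) * u $ 2 + (w $ 1 * v $ 1 + w $ 2 * v $ 2) * v $ 2 = w $ 2"
    by algebra+
  then show ?thesis by (simp add: vec_eq_iff forall_2 inner_vec_def sum_2)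
qed

lemma mem_frame_square:
  assumes "orthonormal_frame u v"
  shows "x \<in> frame_square p u v a \<longleftrightarrow>
    0 \<le> (x - p) \<bullet> u \<and> (x - p) \<bullet> u \<le> a \<and> 0 \<le> (x - p) \<bullet> v \<and> (x - p) \<bullet> v \<le> a"
proof
  assume "x \<in> frame_square p u v a"
  then obtain X Y where x: "x = p + X *\<^sub>R u + Y *\<^sub>R v" and XY: "0 \<le> X" "X \<le> a" "0 \<le> Y" "Y \<le> a"
    by (auto simp: frame_square_def)
  have "u \<bullet> u = 1" "v \<bullet> v = 1" "u \<bullet> v = 0" "v \<bullet> u = 0"
    using assms by (simp_all add: orthonormal_frame_def norm_eq_1 inner_commute)
  then have "(x - p) \<bullet> u = X" "(x - p) \<bullet> v = Y" by (simp_all add: x inner_add_left)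
  then show "0 \<le> (x - p) \<bullet> u \<and> (x - p) \<bullet> u \<le> a \<and> 0 \<le> (x - p) \<bullet> v \<and> (x - p) \<bullet> v \<le> a"
    using XY by simp
next
  assume "0 \<le> (x - p) \<bullet> u \<and> (x - p) \<bullet> u \<le> a \<and> 0 \<le> (x - p) \<bullet> v \<and> (x - p) \<bullet> v \<le> a"
  moreover have "x = p + ((x - p) \<bullet> u) *\<^sub>R u + ((x - p) \<bullet> v) *\<^sub>R v"
    using frame_expand[OF assms, of "x - p"] by (simp add: add.assoc)
  ultimately show "x \<in> frame_square p u v a" unfolding frame_square_def by blast
qed

lemma interior_frame_square:
  assumes "orthonormal_frame u v"
  shows "x \<in> interior (frame_square p u v a) \<longleftrightarrow>
    0 < (x - p) \<bullet> u \<and> (x - p) \<bullet> u < a \<and> 0 < (x - p) \<bullet> v \<and> (x - p) \<bullet> v < a"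
proof -
  have "u \<noteq> 0" "v \<noteq> 0" using assms by (auto simp: orthonormal_frame_def)
  have "frame_square p u v a =
      {x. u \<bullet> x \<ge> u \<bullet> p} \<inter> {x. u \<bullet> x \<le> a + u \<bullet> p} \<inter> {x. v \<bullet> x \<ge> v \<bullet> p} \<inter> {x. v \<bullet> x \<le> a + v \<bullet> p}"
    by (auto simp: mem_frame_square[OF assms] inner_diff_left inner_diff_right inner_commute[of _ u] inner_commute[of _ v])
  then show ?thesis
    using \<open>u \<noteq> 0\<close> \<open>v \<noteq> 0\<close> interior_halfspace_ge[of u] interior_halfspace_ge[of v]
    by (simp add: interior_Int interior_halfspace_le inner_diff_left inner_diff_right inner_commute[of _ u] inner_commute[of _ v]) linarith
qed

lemma usq_rotate: "usq A B (- S) C x y \<longleftrightarrow> usq A B C S x y"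
proof -
  have "(x - A) * - S + (y - B) * C = (y - B) * C - (x - A) * S"
    "(y - B) * - S - (x - A) * C = - ((x - A) * C + (y - B) * S)" by simp_all
  then show ?thesis unfolding usq_def by (simp only: abs_minus_cancel conj_commute)
qed

lemma usq_uminus: "usq A B (- C) (- S) x y \<longleftrightarrow> usq A B C S x y"
  by (simp only: usq_rotate)

lemma usq_normalize:
  assumes "C\<^sup>2 + S\<^sup>2 = 1"
  obtains c sn where "direction c sn" "\<And>x y. usq A B c sn x y \<longleftrightarrow> usq A B C S x y"
proof -
  consider "C \<ge> 0" "S \<ge> 0" | "C \<ge> 0" "S \<le> 0" | "C \<le> 0" "S \<le> 0" | "C \<le> 0" "S \<ge> 0" by linarith
  then show thesis
  proof cases
    case 1
    then have "direction C S" using assms by (simp add: direction_def)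
    then show thesis using that by blast
  next
    case 2
    then have "direction (- S) C" using assms by (simp add: direction_def)
    then show thesis using that usq_rotate by blast
  next
    case 3
    then have "direction (- C) (- S)" using assms by (simp add: direction_def)
    then show thesis using that usq_uminus by blast
  next
    case 4
    have "usq A B S (- C) x y \<longleftrightarrow> usq A B C S x y" for x y
      using usq_rotate[of A B "- S" "- C" x y] usq_uminus[of A B C S x y] by (simp only: minus_minus)
    moreover have "direction S (- C)" using 4 assms by (simp add: direction_def)
    ultimately show thesis using that by blast
  qed
qed

lemma inscribedI:
  assumes dir: "direction c sn" and box: "\<And>x y. usq a b c sn x y \<Longrightarrow> 0 \<le> x \<and> x \<le> 6 \<and> 0 \<le> y \<and> y \<le> 6"
  shows "inscribed a b c sn"
proof -
  have cc: "c * c = 1 - sn * sn" using dir by (simp add: direction_def power2_eq_square algebra_simps)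
  \<comment> \<open>Relative to the centre, the four corners are (-h, g), (h, -g), (g, h) and (-g,
    -h).\<close>
  define g h where "g = (c - sn) / 2" and "h = (c + sn) / 2"
  have e: "h * c - g * sn = 1 / 2" "g * c + h * sn = 1 / 2"
    by (simp_all add: g_def h_def field_simps cc)
  have corner: "usq a b c sn (a + X) (b + Y)" if "\<bar>X * c + Y * sn\<bar> = 1 / 2" "\<bar>Y * c - X * sn\<bar> = 1 / 2" for X Y
    using that by (simp add: usq_def)
  have "usq a b c sn (a + - h) (b + g)"
    by (rule corner) (use e in \<open>simp_all add: abs_if\<close>)
  moreover have "usq a b c sn (a + h) (b + - g)"
    by (rule corner) (use e in \<open>simp_all add: abs_if\<close>)
  moreover have "usq a b c sn (a + g) (b + h)"
    by (rule corner) (use e in \<open>simp_all add: abs_if\<close>)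
  moreover have "usq a b c sn (a + - g) (b + - h)"
    by (rule corner) (use e in \<open>simp_all add: abs_if\<close>)
  ultimately have "0 \<le> a - h" "a + h \<le> 6" "0 \<le> b - h" "b + h \<le> 6"
    using box by (metis diff_conv_add_uminus)+
  then show ?thesis using dir unfolding inscribed_def h_def[symmetric] by simp
qed

text \<open>Enlarging the container to side 6 gives the packed squares side 6 / b > 1. Concentric
  unit squares then lie in their interiors and satisfy \<open>disjoint_squares\<close>.\<close>

lemma not_packable:
  assumes "b < 6"
  shows "\<not> packable 33 b"
proof
  assume "packable 33 b"
  then obtain S Q where S: "is_square b S" and Q: "is_packing 33 Q S" by (auto simp: packable_def)
  obtain p u v where b: "b > 0" and uv: "orthonormal_frame u v" and S_eq: "S = frame_square p u v b"
    using S by (auto simp: is_square_def)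
  have "\<forall>i. \<exists>q f g. i < 33 \<longrightarrow> orthonormal_frame f g \<and> Q i = frame_square q f g 1"
    using Q by (auto simp: is_packing_def is_square_def)
  then obtain q f g where fg: "\<And>i. i < 33 \<Longrightarrow> orthonormal_frame (f i) (g i)"
    and Q_eq: "\<And>i. i < 33 \<Longrightarrow> Q i = frame_square (q i) (f i) (g i) 1"
    by metis
  define r where "r = b / 6"
  have r: "0 < r" "r < 1" using b assms by (simp_all add: r_def)
  define \<Phi> where "\<Phi> x y = p + (r * x) *\<^sub>R u + (r * y) *\<^sub>R v" for x y
  have sq: "\<exists>A B c sn. direction c sn \<and> (\<forall>x y. usq A B c sn x y \<longrightarrow> \<Phi> x y \<in> interior (Q i))"
    if i: "i < 33" for i
  proof -
    define z where "z = q i + (1 / 2) *\<^sub>R f i + (1 / 2) *\<^sub>R g i"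
    define A B C D where "A = ((z - p) \<bullet> u) / r" and "B = ((z - p) \<bullet> v) / r"
      and "C = f i \<bullet> u" and "D = f i \<bullet> v"
    have ff: "f i \<bullet> f i = 1" "g i \<bullet> g i = 1" "f i \<bullet> g i = 0" "g i \<bullet> f i = 0"
      and uu: "u \<bullet> u = 1" "v \<bullet> v = 1" "u \<bullet> v = 0" "v \<bullet> u = 0"
      using fg[OF i] uv by (simp_all add: orthonormal_frame_def norm_eq_1 inner_commute)
    have dot: "x \<bullet> y = (x \<bullet> u) * (y \<bullet> u) + (x \<bullet> v) * (y \<bullet> v)" for x y
    proof -
      have "x \<bullet> y = ((x \<bullet> u) *\<^sub>R u + (x \<bullet> v) *\<^sub>R v) \<bullet> y" by (simp only: frame_expand[OF uv])
      then show ?thesis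
        by (simp only: inner_add_left inner_scaleR_left inner_commute[of u y] inner_commute[of v y])
    qed
    define G H where "G = g i \<bullet> u" and "H = g i \<bullet> v"
    have CD: "C * C + D * D = 1" "G * G + H * H = 1" "C * G + D * H = 0"
      using dot[of "f i" "f i"] dot[of "g i" "g i"] dot[of "f i" "g i"] ff by (simp_all add: C_def D_def G_def H_def)
    \<comment> \<open>\<open>E\<close> is the orientation of the frame of \<open>Q i\<close>
      relative to \<open>u\<close> and \<open>v\<close>; its sign disappears in the absolute values
      of \<open>usq\<close>.\<close>
    define E where "E = C * H - D * G"
    have GH: "G = - E * D" "H = E * C" "E * E = 1"
      unfolding E_def using CD by algebra+
    have E: "\<bar>E\<bar> = 1" using GH(3) by (simp add: abs_square_eq_1 power2_eq_square flip: power2_eq_square)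
    have inQ: "\<Phi> x y \<in> interior (Q i)" if U: "usq A B C D x y" for x y
    proof -
      define X Y where "X = x - A" and "Y = y - B"
      have cz: "(\<Phi> x y - z) \<bullet> u = r * X" "(\<Phi> x y - z) \<bullet> v = r * Y"
        using r by (simp_all add: \<Phi>_def X_def Y_def A_def B_def inner_add_left inner_diff_left uu field_simps)
      have "\<Phi> x y - q i = (\<Phi> x y - z) + (1 / 2) *\<^sub>R f i + (1 / 2) *\<^sub>R g i" by (simp add: z_def)
      then have "(\<Phi> x y - q i) \<bullet> f i = (\<Phi> x y - z) \<bullet> f i + 1 / 2" "(\<Phi> x y - q i) \<bullet> g i = (\<Phi> x y - z) \<bullet> g i + 1 / 2"
        by (simp_all only: inner_add_left inner_scaleR_left ff)
      moreover have "(\<Phi> x y - z) \<bullet> f i = r * (X * C + Y * D)" "(\<Phi> x y - z) \<bullet> g i = r * (E * (Y * C - X * D))"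
        using dot[of "\<Phi> x y - z" "f i"] dot[of "\<Phi> x y - z" "g i"] cz
        by (simp_all add: GH(1,2) flip: C_def D_def G_def H_def) (simp_all add: algebra_simps)
      moreover have "\<bar>r * t\<bar> < 1 / 2" if "\<bar>t\<bar> \<le> 1 / 2" for t
      proof -
        have "\<bar>r * t\<bar> = r * \<bar>t\<bar>" using r by (simp add: abs_mult)
        also have "\<dots> \<le> r * (1 / 2)" using that r by (intro mult_left_mono) simp_all
        also have "\<dots> < 1 / 2" using r by simp
        finally show ?thesis .
      qed
      moreover have "\<bar>X * C + Y * D\<bar> \<le> 1 / 2" "\<bar>E * (Y * C - X * D)\<bar> \<le> 1 / 2"
        using U E by (simp_all add: usq_def X_def Y_def abs_mult)
      ultimately have "\<bar>(\<Phi> x y - q i) \<bullet> f i - 1 / 2\<bar> < 1 / 2" "\<bar>(\<Phi> x y - q i) \<bullet> g i - 1 / 2\<bar> < 1 / 2"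
        by simp_all
      then show ?thesis
        unfolding Q_eq[OF i] interior_frame_square[OF fg[OF i]] abs_less_iff by linarith
    qed
    obtain c sn where "direction c sn" "\<And>x y. usq A B c sn x y \<longleftrightarrow> usq A B C D x y"
      using usq_normalize[of C D A B] CD(1) by (metis power2_eq_square)
    then show ?thesis using inQ by blast
  qed
  then obtain A B c sn where dir: "\<And>i. i < 33 \<Longrightarrow> direction (c i) (sn i)"
    and inQ: "\<And>i x y. i < 33 \<Longrightarrow> usq (A i) (B i) (c i) (sn i) x y \<Longrightarrow> \<Phi> x y \<in> interior (Q i)"
    by metis
  interpret disjoint_squares A B c sn
  proof
    fix n :: nat assume n: "n < 33"
    show "inscribed (A n) (B n) (c n) (sn n)"
    proof (rule inscribedI[OF dir[OF n]])
      fix x y assume "usq (A n) (B n) (c n) (sn n) x y"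
      then have "\<Phi> x y \<in> Q n" using inQ[OF n] interior_subset by blast
      then have "\<Phi> x y \<in> frame_square p u v b" using Q n S_eq by (auto simp: is_packing_def)
      moreover have "u \<bullet> u = 1" "v \<bullet> v = 1" "u \<bullet> v = 0" "v \<bullet> u = 0"
        using uv by (simp_all add: orthonormal_frame_def norm_eq_1 inner_commute)
      ultimately have "0 \<le> r * x \<and> r * x \<le> b \<and> 0 \<le> r * y \<and> r * y \<le> b"
        by (simp add: mem_frame_square[OF uv] \<Phi>_def inner_add_left)
      moreover have "b = r * 6" by (simp add: r_def)
      ultimately show "0 \<le> x \<and> x \<le> 6 \<and> 0 \<le> y \<and> y \<le> 6"
        using r by (simp add: zero_le_mult_iff)
    qed
  next
    fix n n' :: nat and x y
    assume "n < 33" "n' < 33" "usq (A n) (B n) (c n) (sn n) x y" "usq (A n') (B n') (c n') (sn n') x y"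
    then have "\<Phi> x y \<in> interior (Q n) \<inter> interior (Q n')" using inQ by blast
    then show "n = n'"
      using Q \<open>n < 33\<close> \<open>n' < 33\<close> unfolding is_packing_def disjoint_family_on_def by blast
  qed
  show False by (rule no_33_disjoint_squares)
qed

section \<open>The chess board packing\<close>

lemma trivial_packing_is_packing:
  assumes "trivial_packing m n Q S" "m > 0"
  shows "is_square (real m) S" "is_packing n Q S"
proof -
  obtain p u v c where uv: "orthonormal_frame u v" and S: "S = frame_square p u v (real m)"
    and c: "inj_on c {..<n}" "c ` {..<n} \<subseteq> {..<m} \<times> {..<m}" and Q: "\<And>i. i < n \<Longrightarrow> Q i = grid_cell p u v (c i)"
    using assms(1) by (auto simp: trivial_packing_def)
  show "is_square (real m) S" using uv S assms(2) by (auto simp: is_square_def)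
  have uu: "u \<bullet> u = 1" "v \<bullet> v = 1" "u \<bullet> v = 0" "v \<bullet> u = 0"
    using uv by (simp_all add: orthonormal_frame_def norm_eq_1 inner_commute)
  have Qi: "Q i = frame_square (p + real (fst (c i)) *\<^sub>R u + real (snd (c i)) *\<^sub>R v) u v 1" if "i < n" for i
    using Q[OF that] by (simp add: grid_cell_def split_beta)
  have shift: "(x - (p + real j *\<^sub>R u + real k *\<^sub>R v)) \<bullet> u = (x - p) \<bullet> u - real j"
    "(x - (p + real j *\<^sub>R u + real k *\<^sub>R v)) \<bullet> v = (x - p) \<bullet> v - real k" for x j k
    by (simp_all add: inner_diff_left inner_add_left uu)
  show "is_packing n Q S"
    unfolding is_packing_def
  proof (intro conjI allI impI)
    fix i assume i: "i < n"
    show "is_square 1 (Q i)" using Qi[OF i] uv by (auto simp: is_square_def)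
    have "c i \<in> {..<m} \<times> {..<m}" using c(2) i by blast
    then have "real (fst (c i)) + 1 \<le> real m" "real (snd (c i)) + 1 \<le> real m" by auto
    then show "Q i \<subseteq> S" by (auto simp: Qi[OF i] S mem_frame_square[OF uv] shift)
  next
    show "disjoint_family_on (\<lambda>i. interior (Q i)) {..<n}"
      unfolding disjoint_family_on_def
    proof (intro ballI impI)
      fix i j assume ij: "i \<in> {..<n}" "j \<in> {..<n}" "i \<noteq> j"
      show "interior (Q i) \<inter> interior (Q j) = {}"
      proof (rule ccontr)
        assume "interior (Q i) \<inter> interior (Q j) \<noteq> {}"
        then obtain x where "x \<in> interior (Q i)" "x \<in> interior (Q j)" by blast
        \<comment> \<open>Open unit intervals with integral end points that meet are equal.\<close>
        then have "fst (c i) = fst (c j)" "snd (c i) = snd (c j)"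
          using ij by (simp_all add: Qi interior_frame_square[OF uv] shift)
        then show False using c(1) ij by (auto simp: inj_on_def prod_eq_iff)
      qed
    qed
  qed
qed

text \<open>Provides the bound s 33 \<le> 6, and shows that the statement about trivial packings is
  not vacuous.\<close>

lemma trivial_packing_exists:
  assumes "n \<le> m * m"
  shows "\<exists>Q S. trivial_packing m n Q S"
proof -
  define u v :: "real^2" where "u = axis 1 1" and "v = axis 2 1"
  have uv: "orthonormal_frame u v" by (simp add: orthonormal_frame_def u_def v_def inner_axis_axis)
  define c where "c i = (i div m, i mod m)" for i
  have "inj_on c {..<n}" by (rule inj_onI) (metis c_def div_mult_mod_eq prod.inject)
  moreover have "c ` {..<n} \<subseteq> {..<m} \<times> {..<m}"
  proof
    fix l assume "l \<in> c ` {..<n}"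
    then obtain i where i: "i < n" "l = c i" by blast
    then have "i < m * m" using assms by simp
    then have "i div m < m" "m > 0" by (auto simp: less_mult_imp_div_less intro: gr0I)
    then show "l \<in> {..<m} \<times> {..<m}" by (simp add: i c_def)
  qed
  ultimately have "trivial_packing m n (\<lambda>i. grid_cell 0 u v (c i)) (frame_square 0 u v (real m))"
    unfolding trivial_packing_def using uv by blast
  then show ?thesis by blast
qed

theorem corollary10:
  shows "(\<forall>Q S. trivial_packing 6 33 Q S \<longrightarrow> optimal_packing 33 6 Q S) \<and> s 33 = 6"
proof
  show "\<forall>Q S. trivial_packing 6 33 Q S \<longrightarrow> optimal_packing 33 6 Q S"
    using trivial_packing_is_packing[of 6 33] not_packable by (auto simp: optimal_packing_def)
  have "packable 33 6"
    using trivial_packing_exists[of 33 6] trivial_packing_is_packing[of 6 33]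
    by (fastforce simp: packable_def)
  then show "s 33 = 6"
    unfolding s_def using not_packable by (intro Least_equality) (auto simp: not_less[symmetric])
qed

end
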